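(* Let $f_A:\mathbb T^2\to\mathbb T^2$ be a linear Anosov diffeomorphism. If $g\in\mathcal Z^0(f_A)$ has positive topological entropy, then $g$ is a root of an Anosov diffeomorphism, i.e. there is an integer $k\ge1$ such that $g^k$ is an Anosov diffeomorphism of $\mathbb T^2$.
   Context: $\mathbb T^2=\mathbb R^2/\mathbb Z^2$; $f_A$ is the diffeomorphism induced by a matrix $A\in GL(2,\mathbb Z)$, $|\det A|=1$, with no eigenvalue of modulus $1$. $\mathcal Z^0(f_A)$ is the group of homeomorphisms $g$ of $\mathbb T^2$ with $g\circ f_A=f_A\circ g$. A diffeomorphism $F$ of $\mathbb T^2$ is Anosov if there are a $DF$-invariant splitting $T\mathbb T^2=E^s\oplus E^u$ and constants $C>0,\lambda\in(0,1)$ with $\|DF^n(x)|_{E^s_x}\|\le C\lambda^n$ and $\|(DF^n(x)|_{E^u_x})^{-1}\|\le C\lambda^n$ for all $x$ and $n\ge1$. *)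

theory Defs
  imports "HOL-Analysis.Analysis"
begin

section \<open>The two-dimensional torus\<close>

quotient_type torus = "real^2" / "\<lambda>x y. \<forall>i. x $ i - y $ i \<in> \<int>"
proof (rule equivpI)
  show "reflp (\<lambda>x y::real^2. \<forall>i. x $ i - y $ i \<in> \<int>)"
    by (simp add: reflp_def)
  show "symp (\<lambda>x y::real^2. \<forall>i. x $ i - y $ i \<in> \<int>)"
    unfolding symp_def by (metis Ints_minus minus_diff_eq)
  show "transp (\<lambda>x y::real^2. \<forall>i. x $ i - y $ i \<in> \<int>)"
    unfolding transp_def by (metis Ints_add diff_add_cancel add_diff_eq)
qed

abbreviation torus_proj :: "real^2 \<Rightarrow> torus" where
  "torus_proj \<equiv> abs_torus"

instantiation torus :: topological_space
begin

definition open_torus :: "torus set \<Rightarrow> bool" where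
  "open_torus S \<longleftrightarrow> open (torus_proj -` S)"

instance
  by standard (auto simp: open_torus_def vimage_Union)

end

section \<open>Linear Anosov diffeomorphisms and the centralizer\<close>

lemma map_matrix_mult_lattice:
  fixes A :: "int^2^2" and x y :: "real^2"
  assumes "\<forall>i. x $ i - y $ i \<in> \<int>"
  shows "\<forall>i. (map_matrix real_of_int A *v x) $ i - (map_matrix real_of_int A *v y) $ i \<in> \<int>"
proof
  fix i :: 2
  have "(map_matrix real_of_int A *v x) $ i - (map_matrix real_of_int A *v y) $ i
      = (\<Sum>j\<in>UNIV. real_of_int (A $ i $ j) * (x $ j - y $ j))"
    by (simp add: matrix_vector_mult_def map_matrix_def sum_subtractf algebra_simps)
  also have "\<dots> \<in> \<int>"
    by (intro Ints_sum Ints_mult Ints_of_int) (use assms in auto)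
  finally show "(map_matrix real_of_int A *v x) $ i - (map_matrix real_of_int A *v y) $ i \<in> \<int>" .
qed

lift_definition torus_map :: "int^2^2 \<Rightarrow> torus \<Rightarrow> torus"
  is "\<lambda>A x. map_matrix real_of_int A *v x"
  using map_matrix_mult_lattice by blast

definition is_eigenvalue :: "complex^'n^'n \<Rightarrow> complex \<Rightarrow> bool" where
  "is_eigenvalue M c \<longleftrightarrow> (\<exists>v. v \<noteq> 0 \<and> M *v v = c *s v)"

definition hyperbolic_matrix :: "int^'n^'n \<Rightarrow> bool" where
  "hyperbolic_matrix A \<longleftrightarrow> (\<forall>c. is_eigenvalue (map_matrix complex_of_int A) c \<longrightarrow> norm c \<noteq> 1)"

definition homeo_centralizer :: "('a \<Rightarrow> 'a) \<Rightarrow> ('a::topological_space \<Rightarrow> 'a) set" where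
  "homeo_centralizer f = {g. (\<exists>h. homeomorphism UNIV UNIV g h) \<and> g \<circ> f = f \<circ> g}"

section \<open>Topological entropy\<close>

text \<open>The definition by Adler, Konheim and McAndrew. It is meaningful for continuous maps of
  compact spaces, where all the cardinals below are finite and, by subadditivity, the \<open>limsup\<close>
  is a limit.\<close>

definition is_open_cover :: "'a::topological_space set set \<Rightarrow> bool" where
  "is_open_cover \<U> \<longleftrightarrow> (\<forall>U\<in>\<U>. open U) \<and> \<Union>\<U> = UNIV"

definition cover_number :: "'a set set \<Rightarrow> nat" where
  "cover_number \<U> = (LEAST n. \<exists>\<V>\<subseteq>\<U>. finite \<V> \<and> \<Union>\<V> = UNIV \<and> card \<V> = n)"

definition dynamical_join :: "('a \<Rightarrow> 'a) \<Rightarrow> 'a set set \<Rightarrow> nat \<Rightarrow> 'a set set" where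
  "dynamical_join f \<U> n = {\<Inter>i<n. (f ^^ i) -` V i | V. \<forall>i<n. V i \<in> \<U>}"

definition cover_entropy :: "('a \<Rightarrow> 'a) \<Rightarrow> 'a set set \<Rightarrow> ereal" where
  "cover_entropy f \<U> = limsup (\<lambda>n. ereal (ln (real (cover_number (dynamical_join f \<U> n))) / real n))"

definition topological_entropy :: "('a::topological_space \<Rightarrow> 'a) \<Rightarrow> ereal" where
  "topological_entropy f = (SUP \<U>\<in>{\<U>. is_open_cover \<U>}. cover_entropy f \<U>)"

section \<open>Differentiable maps of the torus\<close>

text \<open>Only used for open sets \<open>U\<close>.\<close>

fun Ck_on :: "nat \<Rightarrow> 'a::real_normed_vector set \<Rightarrow> ('a \<Rightarrow> 'b::real_normed_vector) \<Rightarrow> bool" where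
  "Ck_on 0 U f \<longleftrightarrow> continuous_on U f"
| "Ck_on (Suc k) U f \<longleftrightarrow>
     (\<forall>x\<in>U. f differentiable at x) \<and> (\<forall>v. Ck_on k U (\<lambda>x. frechet_derivative f (at x) v))"

definition smooth_on :: "'a::real_normed_vector set \<Rightarrow> ('a \<Rightarrow> 'b::real_normed_vector) \<Rightarrow> bool" where
  "smooth_on U f \<longleftrightarrow> (\<forall>k. Ck_on k U f)"

text \<open>The inverses of the restrictions of \<^term>\<open>torus_proj\<close> to small open sets are the charts of
  the torus, so a local lift is a coordinate representation of \<open>F\<close>. The charts differ by
  translations, hence they trivialize the tangent bundle: every tangent space is identified
  with \<open>\<real>\<^sup>2\<close>, with its Euclidean norm, and the derivative of \<open>F\<close> at \<open>p\<close> becomes a linear map of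
  \<open>\<real>\<^sup>2\<close> that does not depend on the chosen lift.\<close>

definition local_lift :: "(torus \<Rightarrow> torus) \<Rightarrow> (real^2) set \<Rightarrow> (real^2 \<Rightarrow> real^2) \<Rightarrow> bool" where
  "local_lift F U \<phi> \<longleftrightarrow>
     open U \<and> continuous_on U \<phi> \<and> (\<forall>z\<in>U. torus_proj (\<phi> z) = F (torus_proj z))"

definition smooth_torus_map :: "(torus \<Rightarrow> torus) \<Rightarrow> bool" where
  "smooth_torus_map F \<longleftrightarrow> (\<forall>x. \<exists>U \<phi>. x \<in> U \<and> local_lift F U \<phi> \<and> smooth_on U \<phi>)"

definition torus_diffeo :: "(torus \<Rightarrow> torus) \<Rightarrow> bool" where
  "torus_diffeo F \<longleftrightarrow> bij F \<and> smooth_torus_map F \<and> smooth_torus_map (inv F)"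

definition has_torus_derivative ::
    "(torus \<Rightarrow> torus) \<Rightarrow> (real^2 \<Rightarrow> real^2) \<Rightarrow> torus \<Rightarrow> bool" where
  "has_torus_derivative F L p \<longleftrightarrow>
     (\<exists>x U \<phi>. torus_proj x = p \<and> x \<in> U \<and> local_lift F U \<phi> \<and> (\<phi> has_derivative L) (at x))"

definition torus_derivative :: "(torus \<Rightarrow> torus) \<Rightarrow> torus \<Rightarrow> real^2 \<Rightarrow> real^2" where
  "torus_derivative F p = (THE L. has_torus_derivative F L p)"

section \<open>Anosov diffeomorphisms\<close>

text \<open>The operator norm of the restriction of \<open>T\<close> to the subspace \<open>E\<close>; it is \<^const>\<open>onorm\<close>
  for \<open>E = UNIV\<close>.\<close>

definition onorm_on :: "'a::real_normed_vector set \<Rightarrow> ('a \<Rightarrow> 'b::real_normed_vector) \<Rightarrow> real" where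
  "onorm_on E T = (SUP v\<in>E. norm (T v) / norm v)"

definition direct_sum_decomposition :: "'a::real_vector set \<Rightarrow> 'a set \<Rightarrow> bool" where
  "direct_sum_decomposition E E' \<longleftrightarrow>
     subspace E \<and> subspace E' \<and> E \<inter> E' = {0} \<and> {v + w | v w. v \<in> E \<and> w \<in> E'} = UNIV"

text \<open>Continuity of the splitting is not required: it follows from the uniform estimates.\<close>

definition anosov_diffeo :: "(torus \<Rightarrow> torus) \<Rightarrow> bool" where
  "anosov_diffeo F \<longleftrightarrow> torus_diffeo F \<and>
     (\<exists>Es Eu C lam.
        (\<forall>p. direct_sum_decomposition (Es p) (Eu p)) \<and>
        (\<forall>p. torus_derivative F p ` Es p = Es (F p)) \<and>
        (\<forall>p. torus_derivative F p ` Eu p = Eu (F p)) \<and>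
        0 < C \<and> 0 < lam \<and> lam < 1 \<and>
        (\<forall>p. \<forall>n\<ge>1.
           onorm_on (Es p) (torus_derivative (F ^^ n) p) \<le> C * lam ^ n \<and>
           onorm_on (Eu ((F ^^ n) p)) (inv_into (Eu p) (torus_derivative (F ^^ n) p)) \<le> C * lam ^ n))"

end

theory Submission
  imports Defs
begin

text \<open>
The centralizer of a hyperbolic toral automorphism \<open>A\<close> is affine. A lift of \<open>g\<close> to the plane is
the sum of an integer matrix \<open>B\<close>, the action of \<open>g\<close> on the fundamental group, and of a
periodic, hence bounded, map \<open>\<phi>\<close>. Commutation of \<open>g\<close> with \<open>A\<close> says that \<open>B\<close> commutes with
\<open>A\<close> and that \<open>\<psi> = \<phi> - \<phi> 0\<close> satisfies \<open>\<psi> (A x) = A (\<psi> x)\<close>. Projected to an eigenspace of \<open>A\<close>,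
such a map is scaled by an eigenvalue of modulus different from \<open>1\<close> when it is composed with the
bijection \<open>A\<close>; being bounded, it vanishes. So \<open>g\<close> is induced by \<open>x \<mapsto> B x + c\<close>
(\<open>centralizer_affine\<close>), and its inverse is affine for the same reason, whence \<open>det B = \<plusminus>1\<close>.

There are two cases. If \<open>B\<close> is hyperbolic, its eigenvalues \<open>l\<close> and \<open>m\<close> are real with
\<open>\<bar>m\<bar> = 1 / \<bar>l\<bar> < 1\<close>, and \<open>g\<close> itself is Anosov for the constant splitting into the eigenspaces of
\<open>B\<close> (\<open>anosov_affine\<close>). Otherwise the eigenvalues of \<open>B\<close> are roots of unity, and \<open>B\<close> has
finite order, because commuting with \<open>A\<close> excludes nontrivial shears
(\<open>commuting_with_saddle\<close>). Some power of \<open>g\<close> is then a translation that commutes with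
\<open>A\<close>; its vector is rational, as \<open>1\<close> is not an eigenvalue of \<open>A\<close>, so \<open>g\<close> has finite order
(\<open>affine_centralizer_finite_order\<close>). The joins of a cover under a map of finite order have bounded
cover numbers, so its entropy is zero (\<open>topological_entropy_periodic\<close>), contrary to the
hypothesis.
\<close>

section \<open>Continuous maps of the torus and their lifts\<close>

abbreviation real_mat :: "int^2^2 \<Rightarrow> real^2^2" where
  "real_mat \<equiv> map_matrix real_of_int"

definition lattice :: "(real^2) set" where
  "lattice = {m. \<forall>i. m $ i \<in> \<int>}"

lemma torus_proj_eq_iff: "torus_proj x = torus_proj y \<longleftrightarrow> x - y \<in> lattice"
  by (simp add: torus.abs_eq_iff lattice_def)

lemma torus_proj_surj: obtains x where "torus_proj x = p"
  using that[of "rep_torus p"] Quotient3_abs_rep[OF Quotient3_torus] by blast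

lemma lattice_diff: "m \<in> lattice \<Longrightarrow> n \<in> lattice \<Longrightarrow> m - n \<in> lattice"
  and lattice_minus: "m \<in> lattice \<Longrightarrow> - m \<in> lattice"
  and lattice_zero: "0 \<in> lattice"
  and lattice_axis: "axis j 1 \<in> lattice"
  and lattice_scaleR: "k \<in> \<int> \<Longrightarrow> m \<in> lattice \<Longrightarrow> k *\<^sub>R m \<in> lattice"
  by (auto simp: lattice_def axis_def)

lemma real_mat_lattice: "m \<in> lattice \<Longrightarrow> real_mat A *v m \<in> lattice"
  using map_matrix_mult_lattice[of m 0 A] by (simp add: lattice_def matrix_vector_mult_0_right)

lemma lattice_decompose:
  assumes "m \<in> lattice"
  obtains k l where "m = of_int k *\<^sub>R axis 1 1 + of_int l *\<^sub>R axis 2 1"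
proof -
  obtain k l where "m $ 1 = of_int k" "m $ 2 = of_int l"
    using assms unfolding lattice_def by (metis (mono_tags) Ints_cases mem_Collect_eq)
  then have "m = of_int k *\<^sub>R axis 1 1 + of_int l *\<^sub>R axis 2 1"
    by (simp add: vec_eq_iff forall_2 axis_def)
  then show ?thesis by (rule that)
qed

lemma torus_map_proj: "torus_map A (torus_proj x) = torus_proj (real_mat A *v x)"
  by (rule torus_map.abs_eq)

lemma continuous_torus_proj: "continuous_on UNIV torus_proj"
  by (simp add: continuous_on_open_vimage open_torus_def)

lemma continuous_on_torus:
  fixes f :: "torus \<Rightarrow> 'a::topological_space"
  assumes "continuous_on UNIV (\<lambda>x. f (torus_proj x))"
  shows "continuous_on UNIV f"
  using assms by (simp add: continuous_on_open_vimage open_torus_def vimage_def)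

lemma cis_2pi_eq_iff: "cis (2 * pi * x) = cis (2 * pi * y) \<longleftrightarrow> x - y \<in> \<int>"
proof -
  have "cis (2 * pi * x) = cis (2 * pi * (x - y)) * cis (2 * pi * y)"
    by (simp add: cis_mult algebra_simps)
  then have "cis (2 * pi * x) = cis (2 * pi * y) \<longleftrightarrow> cis (2 * pi * (x - y)) = 1"
    by simp
  also have "\<dots> \<longleftrightarrow> x - y \<in> \<int>"
  proof
    assume "cis (2 * pi * (x - y)) = 1"
    then have "cos (2 * pi * (x - y)) = 1"
      by (simp add: complex_eq_iff)
    then obtain n :: int where "2 * pi * (x - y) = of_int n * 2 * pi"
      by (subst (asm) cos_one_2pi_int) blast
    then have "x - y = of_int n"
      by simp
    then show "x - y \<in> \<int>"
      by simp
  qed (rule cis_multiple_2pi)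
  finally show ?thesis .
qed

text \<open>The coordinate characters embed the torus in a product of two circles. They are the reason that
lifts exist: a lift of a torus map is obtained from logarithms of its two characters.\<close>

lift_definition torus_char :: "2 \<Rightarrow> torus \<Rightarrow> complex" is "\<lambda>i x. cis (2 * pi * x $ i)"
  by (simp add: cis_2pi_eq_iff)

lemma torus_char_proj: "torus_char i (torus_proj x) = cis (2 * pi * x $ i)"
  by (rule torus_char.abs_eq)

lemma continuous_torus_char: "continuous_on UNIV (torus_char i)"
proof (rule continuous_on_torus)
  show "continuous_on UNIV (\<lambda>x. torus_char i (torus_proj x))"
    unfolding torus_char_proj cis_conv_exp by (intro continuous_intros)
qed

text \<open>Precomposed with the projection, each character of \<open>g\<close> is a nowhere vanishing function on the
contractible plane, so it has a continuous logarithm. It has modulus one, so the logarithm is purely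
imaginary, and its imaginary part divided by \<open>2\<pi>\<close> is a coordinate of the lift.\<close>

lemma lift_exists:
  assumes "continuous_on UNIV g"
  obtains G where "continuous_on UNIV G" "\<And>x. torus_proj (G x) = g (torus_proj x)"
proof -
  have "\<exists>L. continuous_on UNIV L \<and> (\<forall>x. torus_char i (g (torus_proj x)) = exp (L x))" for i
  proof -
    have "continuous_on UNIV (\<lambda>x. torus_char i (g (torus_proj x)))"
      by (intro continuous_on_compose2[OF continuous_torus_char]
          continuous_on_compose2[OF assms] continuous_torus_proj) auto
    moreover have "torus_char i p \<noteq> 0" for p
      by (rule torus_proj_surj[of p]) (auto simp: torus_char_proj)
    ultimately show ?thesis
      using continuous_logarithm_on_contractible[of UNIV "\<lambda>x. torus_char i (g (torus_proj x))"]
      by (metis UNIV_I contractible_UNIV)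
  qed
  then obtain L where L: "\<And>i. continuous_on UNIV (L i)"
    "\<And>i x. torus_char i (g (torus_proj x)) = exp (L i x)"
    by metis
  define G where "G x = (\<chi> i. Im (L i x) / (2 * pi))" for x
  have "continuous_on UNIV G"
    unfolding G_def by (intro continuous_intros L) auto
  moreover have "torus_proj (G x) = g (torus_proj x)" for x
  proof -
    obtain y where y: "torus_proj y = g (torus_proj x)"
      by (rule torus_proj_surj)
    have "cis (2 * pi * G x $ i) = cis (2 * pi * y $ i)" for i
    proof -
      have e: "exp (L i x) = cis (2 * pi * y $ i)"
        using L(2)[of i x] by (simp add: torus_char_proj flip: y)
      then have "norm (exp (L i x)) = 1"
        by simp
      then have "Re (L i x) = 0"
        by simp
      then have "exp (L i x) = cis (Im (L i x))"
        by (simp add: exp_eq_polar)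
      then show ?thesis
        using e by (simp add: G_def)
    qed
    then have "torus_proj (G x) = torus_proj y"
      by (simp add: torus_proj_eq_iff lattice_def cis_2pi_eq_iff)
    then show ?thesis
      by (simp add: y)
  qed
  ultimately show ?thesis by (rule that)
qed

text \<open>The difference of two lifts of one map is continuous and takes values in a discrete set.\<close>

lemma lift_unique:
  assumes "connected S" "continuous_on S \<phi>" "continuous_on S \<psi>"
    and "\<And>x. x \<in> S \<Longrightarrow> torus_proj (\<phi> x) = torus_proj (\<psi> x)"
  obtains m where "m \<in> lattice" "\<And>x. x \<in> S \<Longrightarrow> \<phi> x = \<psi> x + m"
proof (cases "S = {}")
  case True
  then show ?thesis using that lattice_zero by blast
next
  case False
  then obtain a where a: "a \<in> S" by blast
  have int: "\<phi> x $ i - \<psi> x $ i \<in> \<int>" if "x \<in> S" for x i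
    using assms(4)[OF that] by (simp add: torus_proj_eq_iff lattice_def)
  have const: "\<phi> x $ i - \<psi> x $ i = \<phi> a $ i - \<psi> a $ i" if "x \<in> S" for x i
  proof -
    have "(\<lambda>x. \<phi> x $ i - \<psi> x $ i) constant_on S"
    proof (rule continuous_discrete_range_constant[OF assms(1)])
      show "continuous_on S (\<lambda>x. \<phi> x $ i - \<psi> x $ i)"
        by (intro continuous_intros assms)
      fix x assume x: "x \<in> S"
      have "1 \<le> norm ((\<phi> y $ i - \<psi> y $ i) - (\<phi> x $ i - \<psi> x $ i))"
        if "y \<in> S" "\<phi> y $ i - \<psi> y $ i \<noteq> \<phi> x $ i - \<psi> x $ i" for y
        unfolding real_norm_def
        by (rule Ints_nonzero_abs_ge1) (use that int[OF x] int[OF that(1)] in \<open>auto intro: Ints_diff\<close>)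
      then show "\<exists>e>0. \<forall>y. y \<in> S \<and> \<phi> y $ i - \<psi> y $ i \<noteq> \<phi> x $ i - \<psi> x $ i \<longrightarrow>
          e \<le> norm ((\<phi> y $ i - \<psi> y $ i) - (\<phi> x $ i - \<psi> x $ i))"
        by (intro exI[of _ 1]) auto
    qed
    then show ?thesis
      using that a unfolding constant_on_def by metis
  qed
  show ?thesis
  proof (rule that[of "\<phi> a - \<psi> a"])
    show "\<phi> a - \<psi> a \<in> lattice"
      using int[OF a] by (simp add: lattice_def)
    show "\<phi> x = \<psi> x + (\<phi> a - \<psi> a)" if "x \<in> S" for x
      using const[OF that] by (simp add: vec_eq_iff algebra_simps)
  qed
qed

lemma periodic_int_multiple:
  fixes f :: "'a::real_vector \<Rightarrow> 'b"
  assumes "\<And>x. f (x + e) = f x"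
  shows "f (x + of_int k *\<^sub>R e) = f x"
proof (induction k arbitrary: x rule: int_induct[of _ 0])
  case base
  then show ?case by simp
next
  case (step1 i)
  then show ?case
    using assms[of "x + of_int i *\<^sub>R e"] by (simp add: scaleR_left_distrib add.assoc)
next
  case (step2 i)
  have "x + of_int i *\<^sub>R e = (x + of_int (i - 1) *\<^sub>R e) + e"
    by (simp add: scaleR_left_diff_distrib algebra_simps)
  then show ?case
    using step2 assms by metis
qed

text \<open>The matrix \<open>B\<close> is the action of \<open>g\<close> on the fundamental group \<open>\<int>\<^sup>2\<close>: its \<open>j\<close>-th column is the
displacement of the lift under the translation by the \<open>j\<close>-th basis vector, which is the same at all
points by the uniqueness of lifts.\<close>

lemma lift_linear_part:
  assumes cont: "continuous_on UNIV G" and lift: "\<And>x. torus_proj (G x) = g (torus_proj x)"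
  obtains B where "\<And>x m. m \<in> lattice \<Longrightarrow> G (x + m) - real_mat B *v (x + m) = G x - real_mat B *v x"
proof -
  have "\<exists>b\<in>lattice. \<forall>x. G (x + axis j 1) = G x + b" for j
  proof -
    have "torus_proj (G (x + axis j 1)) = torus_proj (G x)" for x
      using lift by (metis add_diff_cancel_left' lattice_axis torus_proj_eq_iff)
    moreover have "continuous_on UNIV (\<lambda>x. G (x + axis j 1))"
      by (rule continuous_on_compose2[OF cont]) (auto intro: continuous_intros)
    ultimately obtain m where "m \<in> lattice" "\<And>x. x \<in> UNIV \<Longrightarrow> G (x + axis j 1) = G x + m"
      using lift_unique[OF connected_UNIV _ cont] by blast
    then show ?thesis by auto
  qed
  then obtain b where b: "\<And>j. b j \<in> lattice" "\<And>j x. G (x + axis j 1) = G x + b j"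
    by metis
  define B :: "int^2^2" where "B = (\<chi> i j. \<lfloor>b j $ i\<rfloor>)"
  have B: "real_mat B *v axis j 1 = b j" for j
    using b(1)[of j] unfolding lattice_def
    by (auto simp: vec_eq_iff matrix_vector_mult_basis column_def B_def)
  let ?\<phi> = "\<lambda>x. G x - real_mat B *v x"
  have per: "?\<phi> (x + axis j 1) = ?\<phi> x" for x j
    by (simp add: b(2) matrix_vector_right_distrib B)
  have "?\<phi> (x + m) = ?\<phi> x" if "m \<in> lattice" for x m
  proof -
    obtain k l where m: "m = of_int k *\<^sub>R axis 1 1 + of_int l *\<^sub>R axis 2 1"
      by (rule lattice_decompose[OF \<open>m \<in> lattice\<close>])
    show ?thesis
      unfolding m add.assoc[symmetric] by (simp only: periodic_int_multiple[of ?\<phi>, OF per])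
  qed
  then show ?thesis by (rule that)
qed

lemma bounded_periodic:
  fixes f :: "real^2 \<Rightarrow> real^2"
  assumes "continuous_on UNIV f" and per: "\<And>x m. m \<in> lattice \<Longrightarrow> f (x + m) = f x"
  shows "bounded (range f)"
proof -
  have "f x \<in> f ` cbox 0 1" for x
  proof
    let ?m = "(\<chi> i. - of_int \<lfloor>x $ i\<rfloor>) :: real^2"
    show "f x = f (x + ?m)"
      by (rule per[symmetric]) (simp add: lattice_def)
    show "x + ?m \<in> cbox 0 1"
      unfolding mem_box_cart
    proof
      fix i
      show "0 $ i \<le> (x + ?m) $ i \<and> (x + ?m) $ i \<le> 1 $ i"
        using frac_ge_0[of "x $ i"] frac_lt_1[of "x $ i"] by (simp add: frac_def)
    qed
  qed
  moreover have "bounded (f ` cbox 0 1)"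
    using assms(1) by (intro compact_imp_bounded compact_continuous_image compact_cbox)
      (auto intro: continuous_on_subset)
  ultimately show ?thesis
    by (meson bounded_subset image_subsetI)
qed

section \<open>Unimodular integer matrices\<close>

lemma det_invertible_int:
  assumes "invertible (A :: int^2^2)"
  shows "det A = 1 \<or> det A = -1"
proof -
  obtain A' where "A ** A' = mat 1"
    using assms unfolding invertible_def by blast
  then have "det A * det A' = 1"
    by (metis det_I det_mul)
  then show ?thesis
    using zmult_eq_1_iff by blast
qed

lemma trace_2: "trace (A :: 'a::comm_semiring_1^2^2) = A $ 1 $ 1 + A $ 2 $ 2"
  by (simp add: trace_def sum_2)

lemma real_mat_mult: "real_mat (A ** B) = real_mat A ** real_mat B"
  by (simp add: vec_eq_iff matrix_matrix_mult_def)

lemma real_mat_inj: "real_mat A = real_mat B \<Longrightarrow> A = B"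
  by (simp add: vec_eq_iff)

lemma real_mat_one: "real_mat (mat 1) = mat 1"
  by (simp add: vec_eq_iff mat_def)

text \<open>Written for the action on vectors, since eigenspaces are described below as the ranges of the two
linear factors of the characteristic polynomial.\<close>

lemma Cayley_Hamilton_2:
  "real_mat A *v (real_mat A *v x) = of_int (trace A) *\<^sub>R (real_mat A *v x) - of_int (det A) *\<^sub>R x"
  by (simp add: vec_eq_iff forall_2 matrix_vector_mult_def sum_2 trace_2 det_2 algebra_simps)

text \<open>For determinant \<open>\<plusminus>1\<close> these are the traces for which the characteristic polynomial
\<open>X\<^sup>2 - trace A X + det A\<close> has no root on the unit circle. The roots are then real and distinct,
one inside and one outside the circle.\<close>

definition saddle :: "int^2^2 \<Rightarrow> bool" where
  "saddle A \<longleftrightarrow> (det A = 1 \<and> \<bar>trace A\<bar> \<ge> 3) \<or> (det A = -1 \<and> trace A \<noteq> 0)"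

text \<open>In the excluded cases a root on the unit circle is explicit: \<open>1\<close> if the determinant is \<open>-1\<close> and
the trace is \<open>0\<close>, and \<open>t + i \<surd>(1 - t\<^sup>2)\<close> with \<open>t\<close> half the trace if the determinant is \<open>1\<close>.\<close>

lemma saddle_if_hyperbolic:
  assumes "invertible A" and "hyperbolic_matrix A"
  shows "saddle A"
proof (rule ccontr)
  assume "\<not> saddle A"
  then consider "det A = -1" "trace A = 0" | "det A = 1" "\<bar>trace A\<bar> \<le> 2"
    using det_invertible_int[OF assms(1)] by (auto simp: saddle_def)
  then have "\<exists>c::complex. norm c = 1 \<and> c\<^sup>2 - of_int (trace A) * c + of_int (det A) = 0"
  proof cases
    case 1
    then show ?thesis by (intro exI[of _ 1]) simp
  next
    case 2
    define t where "t = real_of_int (trace A) / 2"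
    have "\<bar>t\<bar> \<le> 1"
      using 2 by (simp add: t_def)
    then have s: "(sqrt (1 - t\<^sup>2))\<^sup>2 = 1 - t\<^sup>2"
      by (simp add: abs_square_le_1)
    have tr: "of_int (trace A) = complex_of_real (2 * t)"
      by (simp add: t_def)
    let ?c = "Complex t (sqrt (1 - t\<^sup>2))"
    have "norm ?c = 1"
      by (simp add: cmod_def s)
    moreover have "?c\<^sup>2 - of_int (trace A) * ?c + of_int (det A) = 0"
      unfolding tr using 2 s by (simp add: complex_eq_iff power2_eq_square)
    ultimately show ?thesis by blast
  qed
  then obtain c :: complex where c: "norm c = 1" "c\<^sup>2 - of_int (trace A) * c + of_int (det A) = 0"
    by blast
  let ?M = "map_matrix complex_of_int A"
  have "det (?M - mat c) = c\<^sup>2 - of_int (trace A) * c + of_int (det A)"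
    by (simp add: det_2 trace_2 mat_def power2_eq_square algebra_simps)
  then have "\<not> invertible (?M - mat c)"
    using c by (simp add: invertible_det_nz)
  then obtain v where "v \<noteq> 0" "(?M - mat c) *v v = 0"
    using matrix_left_invertible_ker[of "?M - mat c"] by (auto simp: invertible_left_inverse)
  moreover have "(?M - mat c) *v v = ?M *v v - c *s v" for v
    by (simp add: vec_eq_iff forall_2 matrix_vector_mult_def sum_2 mat_def algebra_simps)
  ultimately have "is_eigenvalue ?M c"
    unfolding is_eigenvalue_def by auto
  then show False
    using assms(2) c(1) unfolding hyperbolic_matrix_def by blast
qed

lemma saddle_eigenvalues:
  assumes "saddle A"
  obtains l m :: real where "l + m = of_int (trace A)" "l * m = of_int (det A)"
    "1 < \<bar>l\<bar>" "\<bar>m\<bar> = 1 / \<bar>l\<bar>"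
proof -
  define t where "t = real_of_int (trace A)"
  define d where "d = real_of_int (det A)"
  have d: "\<bar>d\<bar> = 1"
    using assms by (auto simp: saddle_def d_def)
  have "\<bar>real_of_int (trace A)\<bar> \<ge> 3" if "\<bar>trace A\<bar> \<ge> 3"
    using that by linarith
  moreover have "\<bar>real_of_int (trace A)\<bar> \<ge> 1" if "trace A \<noteq> 0"
    using that by linarith
  ultimately have td: "d = 1 \<and> \<bar>t\<bar> \<ge> 3 \<or> d = -1 \<and> \<bar>t\<bar> \<ge> 1"
    using assms unfolding saddle_def t_def d_def by auto
  define s where "s = sqrt (t\<^sup>2 - 4 * d)"
  have sq: "s\<^sup>2 = t\<^sup>2 - 4 * d \<and> \<bar>t\<bar> + s > 2"
  proof (cases "d = 1")
    case True
    then have "3 \<le> \<bar>t\<bar>" using td by auto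
    then have "3\<^sup>2 \<le> \<bar>t\<bar>\<^sup>2"
      by (rule power_mono) simp
    then have "0 \<le> t\<^sup>2 - 4 * d" using True by simp
    then have "0 \<le> s" "s\<^sup>2 = t\<^sup>2 - 4 * d"
      by (simp_all add: s_def)
    then show ?thesis
      using \<open>3 \<le> \<bar>t\<bar>\<close> by linarith
  next
    case False
    then have *: "d = -1" "1 \<le> \<bar>t\<bar>" using td by auto
    then have "4 \<le> t\<^sup>2 - 4 * d"
      by simp
    then have "sqrt 4 \<le> s" "s\<^sup>2 = t\<^sup>2 - 4 * d"
      unfolding s_def by (simp_all only: real_sqrt_le_iff real_sqrt_pow2_iff)
    then show ?thesis
      using *(2) by simp
  qed
  \<comment> \<open>The sign of the square root is chosen so that no cancellation occurs: the root is the larger one in modulus.\<close>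
  define l where "l = (if t > 0 then (t + s) / 2 else (t - s) / 2)"
  have l1: "1 < \<bar>l\<bar>"
    using sq by (auto simp: l_def)
  have "l\<^sup>2 - t * l + d = 0"
    using sq by (auto simp: l_def power2_eq_square field_simps)
  then have sum: "l + d / l = t"
    using l1 by (auto simp: field_simps power2_eq_square)
  show ?thesis
    by (rule that[of l "d / l"]) (use sum l1 d in \<open>auto simp: t_def d_def\<close>)
qed

text \<open>The vectors \<open>A x - m x\<close> are eigenvectors for \<open>l\<close>, because \<open>(A - l) (A - m) = 0\<close>.\<close>

lemma saddle_factor:
  assumes "l + m = of_int (trace A)" "l * m = of_int (det A)"
  shows "real_mat A *v (real_mat A *v x - m *\<^sub>R x) = l *\<^sub>R (real_mat A *v x - m *\<^sub>R x)"
proof -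
  have "real_mat A *v (real_mat A *v x - m *\<^sub>R x)
      = (l + m) *\<^sub>R (real_mat A *v x) - (l * m) *\<^sub>R x - m *\<^sub>R (real_mat A *v x)"
    unfolding assms by (simp add: matrix_vector_mult_diff_distrib Cayley_Hamilton_2 matrix_vector_mult_scaleR)
  then show ?thesis
    by (simp add: algebra_simps)
qed

lemma surj_real_mat:
  assumes "det A \<noteq> 0"
  shows "\<exists>y. real_mat A *v y = x"
proof
  show "real_mat A *v ((1 / of_int (det A)) *\<^sub>R (of_int (trace A) *\<^sub>R x - real_mat A *v x)) = x"
    using assms
    by (simp add: matrix_vector_mult_scaleR matrix_vector_mult_diff_distrib Cayley_Hamilton_2)
qed

text \<open>In terms of matrix entries: \<open>(x, y; z, -x)\<close> is a nilpotent matrix that commutes with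
\<open>(a, b; c, d)\<close>, whose characteristic polynomial has the discriminant of the first hypothesis. As the
eigenvalues of the latter are distinct, both matrices are diagonal in one basis (over the complex
numbers), and a diagonal nilpotent matrix is zero.\<close>

lemma parabolic_commuting_entries:
  fixes a b c d x y z :: int
  assumes "(a - d)\<^sup>2 + 4 * b * c \<noteq> 0" "x * x + y * z = 0"
    and "b * z = c * y" "(a - d) * y = 2 * x * b" "(a - d) * z = 2 * x * c"
  shows "x = 0 \<and> y = 0 \<and> z = 0"
proof -
  have "y * y * ((a - d)\<^sup>2 + 4 * b * c) = 0" "z * z * ((a - d)\<^sup>2 + 4 * b * c) = 0"
    using assms(2-) by algebra+
  then have "y = 0" "z = 0"
    using assms(1) by auto
  then show ?thesis
    using assms(2) by simp
qed

text \<open>If \<open>B\<close> is not a saddle, its characteristic polynomial is one of \<open>X\<^sup>2 \<plusminus> 1\<close>, \<open>X\<^sup>2 \<plusminus> X + 1\<close> and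
\<open>(X \<plusminus> 1)\<^sup>2\<close>. In the first two cases its roots are distinct roots of unity, so that
\<open>B\<^sup>4\<close> or \<open>B\<^sup>6\<close> is the identity. In the last case \<open>B\<close> could be a shear; commuting with \<open>A\<close> is
what forces \<open>B\<close> to be \<open>\<plusminus>1\<close>. The exponent \<open>12\<close> is the least common multiple of the orders \<open>4\<close>, \<open>6\<close>
and \<open>2\<close>.\<close>

lemma commuting_with_saddle:
  assumes "saddle A" "A ** B = B ** A" "det B = 1 \<or> det B = -1" "\<not> saddle B"
  shows "((\<lambda>x. real_mat B *v x) ^^ 12) = id"
proof -
  define T where "T = (\<lambda>x. real_mat B *v x)"
  have "linear T"
    unfolding T_def by (rule matrix_vector_mul_linear)
  note lin = linear_scale[OF this] linear_diff[OF this] linear_neg[OF this]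
  have CH: "T (T x) = of_int (trace B) *\<^sub>R T x - of_int (det B) *\<^sub>R x" for x
    by (simp add: T_def Cayley_Hamilton_2)
  have twelve: "T ^^ 12 = id" if "\<And>x. (T ^^ k) x = x" "k * j = 12" for k j
  proof -
    have "T ^^ k = id" using that(1) by auto
    then have "(T ^^ k) ^^ j = id" by (simp add: id_funpow)
    then show ?thesis using that(2) by (simp add: funpow_mult mult.commute)
  qed
  have "\<bar>trace B\<bar> \<le> 2" if "det B = 1"
    using assms(4) that unfolding saddle_def by auto
  then consider "trace B = 0" | "det B = 1" "trace B = 1 \<or> trace B = -1"
    | "det B = 1" "trace B = 2 \<or> trace B = -2"
    using assms(3,4) unfolding saddle_def by fastforce
  then have "T ^^ 12 = id"
  proof cases
    case 1
    have "(T ^^ 4) x = x" for x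
      using assms(3) by (auto simp: eval_nat_numeral CH 1 lin)
    then show ?thesis by (rule twelve[of 4 3]) simp
  next
    case 2
    have "(T ^^ 6) x = x" for x
      using 2 by (auto simp: eval_nat_numeral CH lin)
    then show ?thesis by (rule twelve[of 6 2]) simp
  next
    case 3
    \<comment> \<open>The double eigenvalue of B, so that B - e is nilpotent.\<close>
    define e where "e = trace B div 2"
    have e: "e = 1 \<or> e = -1" "trace B = 2 * e"
      using 3 by (auto simp: e_def)
    have "(A $ 1 $ 1 - A $ 2 $ 2)\<^sup>2 + 4 * A $ 1 $ 2 * A $ 2 $ 1 = (trace A)\<^sup>2 - 4 * det A"
      by (simp add: trace_2 det_2 power2_eq_square algebra_simps)
    moreover have "(trace A)\<^sup>2 - 4 * det A \<noteq> 0"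
    proof (cases "det A = 1")
      case True
      then have "3\<^sup>2 \<le> \<bar>trace A\<bar>\<^sup>2"
        using assms(1) by (intro power_mono) (auto simp: saddle_def)
      then show ?thesis using True by simp
    next
      case False
      then have "det A = -1"
        using assms(1) by (auto simp: saddle_def)
      then show ?thesis
        using zero_le_power2[of "trace A"] by linarith
    qed
    ultimately have disc: "(A $ 1 $ 1 - A $ 2 $ 2)\<^sup>2 + 4 * A $ 1 $ 2 * A $ 2 $ 1 \<noteq> 0"
      by simp
    have comm: "(A ** B) $ i $ j = (B ** A) $ i $ j" for i j
      by (simp add: assms(2))
    have B22: "B $ 2 $ 2 = 2 * e - B $ 1 $ 1"
      using e by (simp add: trace_2)
    have "B $ 1 $ 1 - e = 0 \<and> B $ 1 $ 2 = 0 \<and> B $ 2 $ 1 = 0"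
    proof (rule parabolic_commuting_entries[OF disc])
      have "B $ 1 $ 1 * (2 * e - B $ 1 $ 1) - B $ 1 $ 2 * B $ 2 $ 1 = e * e"
        using 3(1) e(1) by (auto simp: det_2 B22)
      then show "(B $ 1 $ 1 - e) * (B $ 1 $ 1 - e) + B $ 1 $ 2 * B $ 2 $ 1 = 0"
        by (simp add: algebra_simps)
      show "A $ 1 $ 2 * B $ 2 $ 1 = A $ 2 $ 1 * B $ 1 $ 2"
        using comm[of 1 1] by (simp add: matrix_matrix_mult_def sum_2 algebra_simps)
      show "(A $ 1 $ 1 - A $ 2 $ 2) * B $ 1 $ 2 = 2 * (B $ 1 $ 1 - e) * A $ 1 $ 2"
        using comm[of 1 2] by (simp add: matrix_matrix_mult_def sum_2 B22 algebra_simps)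
      show "(A $ 1 $ 1 - A $ 2 $ 2) * B $ 2 $ 1 = 2 * (B $ 1 $ 1 - e) * A $ 2 $ 1"
        using comm[of 2 1] by (simp add: matrix_matrix_mult_def sum_2 B22 algebra_simps)
    qed
    then have Tx: "T x = of_int e *\<^sub>R x" for x
      using B22 by (simp add: T_def vec_eq_iff forall_2 matrix_vector_mult_def sum_2)
    have "(T ^^ 2) x = x" for x
      using e(1) by (auto simp: eval_nat_numeral Tx)
    then show ?thesis by (rule twelve[of 2 6]) simp
  qed
  then show ?thesis
    by (simp add: T_def)
qed

section \<open>Rigidity of the centralizer\<close>

text \<open>The plane map \<open>x \<mapsto> T x + c\<close> covers \<open>g\<close>. Keeping \<open>T\<close> a function rather than a matrix makes the
linear part of an iterate of \<open>g\<close> simply an iterate of \<open>T\<close>.\<close>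

definition has_affine_lift :: "(torus \<Rightarrow> torus) \<Rightarrow> (real^2 \<Rightarrow> real^2) \<Rightarrow> real^2 \<Rightarrow> bool" where
  "has_affine_lift g T c \<longleftrightarrow> (\<forall>x. g (torus_proj x) = torus_proj (T x + c))"

lemma has_affine_liftD: "has_affine_lift g T c \<Longrightarrow> g (torus_proj x) = torus_proj (T x + c)"
  by (simp add: has_affine_lift_def)

lemma has_affine_lift_compose:
  assumes "has_affine_lift g T c" "has_affine_lift h S d" "linear T"
  shows "has_affine_lift (g \<circ> h) (T \<circ> S) (T d + c)"
  using assms by (simp add: has_affine_lift_def linear_add add.assoc)

lemma linear_funpow: "linear T \<Longrightarrow> linear (T ^^ n)" for T :: "'a::real_vector \<Rightarrow> 'a"
  by (induction n) (auto intro: linear_compose simp: id_def linear_ident)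

lemma has_affine_lift_funpow:
  assumes "has_affine_lift g T c" "linear T"
  obtains d where "has_affine_lift (g ^^ n) (T ^^ n) d"
proof -
  have "\<exists>d. has_affine_lift (g ^^ n) (T ^^ n) d"
  proof (induction n)
    case 0
    then show ?case by (auto simp: has_affine_lift_def intro: exI[of _ 0])
  next
    case (Suc n)
    then show ?case
      using has_affine_lift_compose[OF assms(1) _ assms(2)] by (metis funpow.simps(2))
  qed
  then show ?thesis using that by blast
qed

lemma continuous_on_affine:
  assumes "linear (T :: 'a::euclidean_space \<Rightarrow> 'b::real_normed_vector)"
  shows "continuous_on U (\<lambda>x. T x + c)"
  by (rule continuous_on_add[OF linear_continuous_on continuous_on_const])
    (use assms in \<open>simp add: linear_conv_bounded_linear\<close>)

lemma affine_lift_unique: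
  assumes "has_affine_lift g T c" "has_affine_lift g S d" "linear T" "linear S"
  shows "T = S"
proof -
  have "continuous_on UNIV (\<lambda>x. T x + c)" "continuous_on UNIV (\<lambda>x. S x + d)"
    by (intro continuous_on_affine assms)+
  moreover have "torus_proj (T x + c) = torus_proj (S x + d)" for x
    using assms(1,2) by (metis has_affine_liftD)
  ultimately obtain m where m: "m \<in> lattice" "\<And>x. x \<in> UNIV \<Longrightarrow> T x + c = S x + d + m"
    using lift_unique[OF connected_UNIV, of "\<lambda>x. T x + c" "\<lambda>x. S x + d"] by blast
  have c: "c = d + m"
    using m(2)[of 0] by (simp add: linear_0 assms)
  show "T = S"
    using m(2) by (auto simp: c)
qed

text \<open>Scaling by \<open>l\<close> multiplies the supremum of \<open>norm \<circ> f\<close> by \<open>\<bar>l\<bar>\<close>, while reparametrizing by a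
surjection keeps it. So the supremum is zero.\<close>

lemma bounded_scaling_eq_zero:
  fixes f :: "'a \<Rightarrow> 'b::real_normed_vector"
  assumes bnd: "bounded (range f)" and scal: "\<And>x. f (\<tau> x) = l *\<^sub>R f x" and "surj \<tau>" "\<bar>l\<bar> \<noteq> 1"
  shows "f x = 0"
proof -
  define S where "S = (SUP x. norm (f x))"
  have bdd: "bdd_above (range (\<lambda>x. norm (f x)))"
    using bnd by (auto simp: bounded_iff bdd_above_def)
  have le: "norm (f x) \<le> S" for x
    unfolding S_def by (rule cSUP_upper[OF UNIV_I bdd])
  have S0: "0 \<le> S"
    using le[of undefined] norm_ge_zero order_trans by blast
  have "S \<le> 0"
  proof (cases "\<bar>l\<bar> < 1")
    case True
    have "norm (f x) \<le> \<bar>l\<bar> * S" for x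
    proof -
      obtain y where "x = \<tau> y" using \<open>surj \<tau>\<close> by blast
      then show ?thesis using le[of y] by (simp add: scal mult_left_mono)
    qed
    then have "S \<le> \<bar>l\<bar> * S"
      unfolding S_def by (intro cSUP_least) auto
    then have "(1 - \<bar>l\<bar>) * S \<le> 0" by (simp add: algebra_simps)
    then show ?thesis using True by (simp add: mult_le_0_iff)
  next
    case False
    have "norm (f x) \<le> S / \<bar>l\<bar>" for x
      using le[of "\<tau> x"] False by (simp add: scal field_simps)
    then have "S \<le> S / \<bar>l\<bar>"
      unfolding S_def by (intro cSUP_least) auto
    then have "(\<bar>l\<bar> - 1) * S \<le> 0" using False by (simp add: field_simps)
    then show ?thesis using False assms(4) by (simp add: mult_le_0_iff)
  qed
  then have "norm (f x) \<le> 0"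
    using le[of x] by linarith
  then show ?thesis
    by simp
qed

text \<open>Both factors \<open>A - r\<close> of the characteristic polynomial turn \<open>\<psi>\<close> into a bounded map that is scaled by
the other eigenvalue, hence into zero. So \<open>\<psi> x\<close> is an eigenvector for two different eigenvalues.\<close>

lemma bounded_saddle_equivariant_eq_zero:
  fixes \<psi> :: "real^2 \<Rightarrow> real^2"
  assumes "saddle A" "bounded (range \<psi>)" and equi: "\<And>x. \<psi> (real_mat A *v x) = real_mat A *v \<psi> x"
  shows "\<psi> x = 0"
proof -
  obtain l m :: real where lm: "l + m = of_int (trace A)" "l * m = of_int (det A)"
    "1 < \<bar>l\<bar>" "\<bar>m\<bar> = 1 / \<bar>l\<bar>"
    using saddle_eigenvalues[OF assms(1)] .
  have m1: "\<bar>m\<bar> < 1"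
    using lm by simp
  have "det A \<noteq> 0"
    using assms(1) by (auto simp: saddle_def)
  then have surj: "surj (\<lambda>x. real_mat A *v x)"
    using surj_real_mat by (metis surjI)
  have eig: "real_mat A *v \<psi> x = r *\<^sub>R \<psi> x"
    if rs: "s + r = of_int (trace A)" "s * r = of_int (det A)" "\<bar>s\<bar> \<noteq> 1" for r s x
  proof -
    let ?f = "\<lambda>x. real_mat A *v \<psi> x - r *\<^sub>R \<psi> x"
    have "bounded (range ?f)"
    proof (rule bounded_minus_comp)
      have "bounded ((\<lambda>y. real_mat A *v y) ` range \<psi>)"
        by (rule bounded_linear_image[OF assms(2)]) (rule matrix_vector_mul_bounded_linear)
      then show "bounded (range (\<lambda>x. real_mat A *v \<psi> x))"
        by (simp add: image_image)
      show "bounded (range (\<lambda>x. r *\<^sub>R \<psi> x))"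
        using bounded_scaling[OF assms(2)] by (simp add: image_image)
    qed
    moreover have "?f (real_mat A *v x) = s *\<^sub>R ?f x" for x
      using saddle_factor[OF rs(1,2), of "\<psi> x"]
      by (simp add: equi matrix_vector_mult_diff_distrib matrix_vector_mult_scaleR)
    ultimately have "?f x = 0"
      using bounded_scaling_eq_zero[of ?f, OF _ _ surj rs(3)] by blast
    then show ?thesis by simp
  qed
  have "real_mat A *v \<psi> x = m *\<^sub>R \<psi> x"
    by (rule eig[of l]) (use lm in simp_all)
  moreover have "real_mat A *v \<psi> x = l *\<^sub>R \<psi> x"
    by (rule eig[of m]) (use lm m1 in \<open>simp_all add: add.commute mult.commute\<close>)
  ultimately have "m *\<^sub>R \<psi> x = l *\<^sub>R \<psi> x"
    by metis
  then show ?thesis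
    using lm(3) m1 by auto
qed

lemma matrix_eq_on_lattice:
  assumes "\<And>m. m \<in> lattice \<Longrightarrow> M *v m = N *v m"
  shows "M = (N :: real^2^2)"
proof -
  have "column j M = column j N" for j
    using assms[OF lattice_axis[of j]] by (simp add: matrix_vector_mult_basis)
  then show ?thesis
    by (simp add: column_def vec_eq_iff)
qed

text \<open>The periodic part \<open>\<phi>\<close> of a lift of \<open>g\<close> is bounded. Commutation with \<open>A\<close> makes it equivariant under
\<open>A\<close> up to a constant, so that \<open>\<phi> - \<phi> 0\<close> is exactly equivariant and therefore vanishes.\<close>

theorem centralizer_affine:
  assumes "saddle A" "continuous_on UNIV g" "g \<circ> torus_map A = torus_map A \<circ> g"
  obtains B c where "has_affine_lift g (\<lambda>x. real_mat B *v x) c" "A ** B = B ** A"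
proof -
  obtain G where G: "continuous_on UNIV G" "\<And>x. torus_proj (G x) = g (torus_proj x)"
    using lift_exists[OF assms(2)] by blast
  obtain B where B: "\<And>x m. m \<in> lattice \<Longrightarrow> G (x + m) - real_mat B *v (x + m) = G x - real_mat B *v x"
    using lift_linear_part[OF G] by blast
  let ?A = "\<lambda>x. real_mat A *v x" and ?B = "\<lambda>x. real_mat B *v x"
  define \<phi> where "\<phi> x = G x - ?B x" for x
  have per: "\<phi> (x + m) = \<phi> x" if "m \<in> lattice" for x m
    using B[OF that] by (simp add: \<phi>_def)
  have cont: "continuous_on UNIV \<phi>"
    unfolding \<phi>_def by (intro continuous_intros G)
  have contA: "continuous_on UNIV (\<lambda>x. ?A (f x))" if "continuous_on UNIV f" for f :: "real^2 \<Rightarrow> real^2"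
    by (rule linear_continuous_on_compose[OF that matrix_vector_mul_linear])
  have cont': "continuous_on UNIV (\<lambda>x. G (?A x))" "continuous_on UNIV (\<lambda>x. ?A (G x))"
    by (rule continuous_on_compose2[OF G(1) contA[OF continuous_on_id]]) (simp_all add: contA G(1))
  have "torus_proj (G (?A x)) = torus_proj (?A (G x))" for x
    using assms(3) by (metis G(2) comp_apply torus_map_proj)
  then obtain k where k: "\<And>x. G (?A x) = ?A (G x) + k"
    using lift_unique[OF connected_UNIV cont'] by (metis UNIV_I)
  have A\<phi>: "\<phi> (?A x) + ?B (?A x) = ?A (\<phi> x) + ?A (?B x) + k" for x
    using k[of x] by (simp add: \<phi>_def matrix_vector_mult_diff_distrib)
  \<comment> \<open>On the lattice the periodic part takes its value at the origin, and only the linear parts remain.\<close>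
  have comm: "?B (?A m) = ?A (?B m)" if m: "m \<in> lattice" for m
  proof -
    have "\<phi> (?A m) = \<phi> 0" "\<phi> m = \<phi> 0"
      using per[of "?A m" 0] per[of m 0] m by (simp_all add: real_mat_lattice)
    then have "\<phi> 0 + ?B (?A m) = (?A (\<phi> 0) + k) + ?A (?B m)"
      using A\<phi>[of m] by (simp add: algebra_simps)
    moreover have "?A (\<phi> 0) + k = \<phi> 0"
      using A\<phi>[of 0] by simp
    ultimately show ?thesis
      by (metis add_left_cancel)
  qed
  have "real_mat (A ** B) = real_mat (B ** A)"
    by (rule matrix_eq_on_lattice) (simp add: real_mat_mult comm flip: matrix_vector_mul_assoc)
  then have AB: "A ** B = B ** A"
    by (rule real_mat_inj)
  then have "?B (?A x) = ?A (?B x)" for x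
    by (metis matrix_vector_mul_assoc real_mat_mult)
  then have \<phi>_eq: "\<phi> (?A x) = ?A (\<phi> x) + k" for x
    using A\<phi>[of x] by simp
  define \<psi> where "\<psi> x = \<phi> x - \<phi> 0" for x
  have "\<psi> x = 0" for x
  proof (rule bounded_saddle_equivariant_eq_zero[OF assms(1), of \<psi>])
    show "bounded (range \<psi>)"
      unfolding \<psi>_def using bounded_periodic[OF cont per]
      by (intro bounded_minus_comp) auto
    have "\<phi> 0 = ?A (\<phi> 0) + k"
      using \<phi>_eq[of 0] by simp
    then have "k = \<phi> 0 - ?A (\<phi> 0)"
      by (metis add_diff_cancel_left')
    then show "\<psi> (?A x) = ?A (\<psi> x)" for x
      using \<phi>_eq[of x] by (simp add: \<psi>_def matrix_vector_mult_diff_distrib)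
  qed
  then have "G x = ?B x + \<phi> 0" for x
    by (metis \<phi>_def \<psi>_def add.commute diff_add_cancel eq_iff_diff_eq_0)
  then have "has_affine_lift g ?B (\<phi> 0)"
    using G(2) by (simp add: has_affine_lift_def)
  then show ?thesis
    using AB by (rule that)
qed

section \<open>Hyperbolic affine maps are Anosov\<close>

lemma Ck_on_const: "Ck_on k U (\<lambda>x. c)"
  by (induction k arbitrary: c) (simp_all add: continuous_on_const)

lemma smooth_on_affine:
  assumes "linear (T :: 'a::euclidean_space \<Rightarrow> 'b::real_normed_vector)"
  shows "smooth_on U (\<lambda>x. T x + c)"
proof -
  have der: "((\<lambda>x. T x + c) has_derivative T) (at x)" for x
    using assms by (auto intro!: derivative_eq_intros linear_imp_has_derivative)
  have "Ck_on k U (\<lambda>x. T x + c)" for k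
  proof (cases k)
    case 0
    then show ?thesis
      using assms by (simp add: continuous_on_affine)
  next
    case (Suc j)
    have "frechet_derivative (\<lambda>x. T x + c) (at x) = T" for x
      using frechet_derivative_at[OF der] by simp
    then show ?thesis
      using der unfolding Suc Ck_on.simps by (auto simp: Ck_on_const differentiable_def)
  qed
  then show ?thesis
    by (simp add: smooth_on_def)
qed

lemma local_lift_affine:
  assumes "has_affine_lift g T c" "linear T"
  shows "local_lift g UNIV (\<lambda>x. T x + c)"
  using assms by (simp add: local_lift_def has_affine_lift_def continuous_on_affine)

lemma smooth_torus_map_affine:
  assumes "has_affine_lift g T c" "linear T"
  shows "smooth_torus_map g"
  unfolding smooth_torus_map_def
  using local_lift_affine[OF assms] smooth_on_affine[OF assms(2)] by blast

text \<open>Near each point any local lift differs from the affine one by a constant, so the derivative is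
unique and the definite description in its definition denotes \<open>T\<close>.\<close>

lemma torus_derivative_affine:
  assumes "has_affine_lift g T c" "linear T"
  shows "torus_derivative g p = T"
proof -
  have der: "((\<lambda>x. T x + c) has_derivative T) (at x)" for x
    using assms(2) by (auto intro!: derivative_eq_intros linear_imp_has_derivative)
  have "has_torus_derivative g T p"
  proof -
    obtain x where "torus_proj x = p"
      by (rule torus_proj_surj)
    then show ?thesis
      unfolding has_torus_derivative_def
      using local_lift_affine[OF assms] der[of x] by blast
  qed
  moreover have "L = T" if "has_torus_derivative g L p" for L
  proof -
    from that obtain x U \<phi> where *: "x \<in> U" "local_lift g U \<phi>" "(\<phi> has_derivative L) (at x)"
      unfolding has_torus_derivative_def by blast
    then obtain e where e: "e > 0" "ball x e \<subseteq> U"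
      unfolding local_lift_def open_contains_ball by auto
    have "continuous_on (ball x e) \<phi>"
      using *(2) e(2) unfolding local_lift_def by (auto intro: continuous_on_subset)
    moreover have "continuous_on (ball x e) (\<lambda>x. T x + c)"
      by (rule continuous_on_affine[OF assms(2)])
    moreover have "torus_proj (\<phi> z) = torus_proj (T z + c)" if "z \<in> ball x e" for z
      using *(2) e(2) that assms(1) unfolding local_lift_def has_affine_lift_def by auto
    ultimately obtain m where m: "\<And>z. z \<in> ball x e \<Longrightarrow> \<phi> z = T z + c + m"
      using lift_unique[OF connected_ball, of x e \<phi> "\<lambda>x. T x + c"] by blast
    have "((\<lambda>z. T z + c + m) has_derivative T) (at x)"
      using assms(2) by (auto intro!: derivative_eq_intros linear_imp_has_derivative)
    then have "(\<phi> has_derivative T) (at x)"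
      by (rule has_derivative_transform_within_open[OF _ open_ball]) (use e m in auto)
    then show ?thesis
      using *(3) has_derivative_unique by blast
  qed
  ultimately show ?thesis
    unfolding torus_derivative_def by blast
qed

lemma onorm_on_le:
  assumes "E \<noteq> {}" "0 \<le> K" "\<And>v. v \<in> E \<Longrightarrow> norm (T v) \<le> K * norm v"
  shows "onorm_on E T \<le> K"
  unfolding onorm_on_def
proof (rule cSUP_least[OF assms(1)])
  fix v assume "v \<in> E"
  then show "norm (T v) / norm v \<le> K"
    using assms(2,3) by (cases "v = 0") (simp_all add: divide_le_eq)
qed

lemma funpow_eigenvector:
  fixes T :: "'a::real_vector \<Rightarrow> 'a"
  assumes "linear T" "T v = r *\<^sub>R v"
  shows "(T ^^ n) v = r ^ n *\<^sub>R v"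
  by (induction n) (simp_all add: linear_scale[OF assms(1)] assms(2) mult.commute)

text \<open>The components of \<open>x\<close> are \<open>(T x - l x) / (m - l)\<close> and \<open>(T x - m x) / (l - m)\<close>; the two hypotheses
on \<open>T\<close> say that these are eigenvectors.\<close>

lemma eigenspaces_direct_sum:
  assumes lin: "linear T" and "l \<noteq> m"
    and l: "\<And>x. T (T x - m *\<^sub>R x) = l *\<^sub>R (T x - m *\<^sub>R x)"
    and m: "\<And>x. T (T x - l *\<^sub>R x) = m *\<^sub>R (T x - l *\<^sub>R x)"
  shows "direct_sum_decomposition {v. T v = m *\<^sub>R v} {v. T v = l *\<^sub>R v}"
  unfolding direct_sum_decomposition_def
proof (intro conjI)
  have "subspace {v. T v = r *\<^sub>R v}" for r
    by (rule subspaceI)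
      (simp_all add: linear_0[OF lin] linear_add[OF lin] linear_scale[OF lin] algebra_simps)
  then show "subspace {v. T v = m *\<^sub>R v}" "subspace {v. T v = l *\<^sub>R v}"
    by auto
  show "{v. T v = m *\<^sub>R v} \<inter> {v. T v = l *\<^sub>R v} = {0}"
    using \<open>l \<noteq> m\<close> by (auto simp: linear_0[OF lin])
  have "x \<in> {v + w |v w. v \<in> {v. T v = m *\<^sub>R v} \<and> w \<in> {v. T v = l *\<^sub>R v}}" for x
  proof -
    let ?v = "(1 / (m - l)) *\<^sub>R (T x - l *\<^sub>R x)" and ?w = "(1 / (l - m)) *\<^sub>R (T x - m *\<^sub>R x)"
    have "T ?v = m *\<^sub>R ?v" "T ?w = l *\<^sub>R ?w"
      by (simp_all add: linear_scale[OF lin] l m)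
    moreover have "x = ?v + ?w"
    proof -
      have "1 / (m - l) = - (1 / (l - m))"
        using \<open>l \<noteq> m\<close> by (simp add: field_simps)
      then have "?v + ?w = (1 / (l - m)) *\<^sub>R ((l - m) *\<^sub>R x)"
        by (simp only: scaleR_minus_left) (simp add: algebra_simps flip: scaleR_diff_right)
      then show ?thesis using \<open>l \<noteq> m\<close> by simp
    qed
    ultimately show ?thesis by blast
  qed
  then show "{v + w |v w. v \<in> {v. T v = m *\<^sub>R v} \<and> w \<in> {v. T v = l *\<^sub>R v}} = UNIV"
    by blast
qed

text \<open>All derivatives are the same linear map, so the constant splitting into its eigenspaces is invariant
and the rates are exact powers of \<open>\<bar>m\<bar> = 1 / \<bar>l\<bar>\<close>. Smoothness of the inverse comes from the fact that
it has an affine lift as well.\<close>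

theorem anosov_affine:
  assumes g: "has_affine_lift g T c" "linear T" and g': "has_affine_lift (inv g) S d" "linear S"
    and "bij g"
    and l: "\<And>x. T (T x - m *\<^sub>R x) = l *\<^sub>R (T x - m *\<^sub>R x)"
    and m: "\<And>x. T (T x - l *\<^sub>R x) = m *\<^sub>R (T x - l *\<^sub>R x)"
    and lm: "1 < \<bar>l\<bar>" "\<bar>m\<bar> = 1 / \<bar>l\<bar>"
  shows "anosov_diffeo g"
proof -
  define E where "E r = {v. T v = r *\<^sub>R v}" for r
  have m0: "0 < \<bar>m\<bar>" "\<bar>m\<bar> < 1"
    unfolding lm(2) using lm(1) by auto
  then have ne: "l \<noteq> 0" "m \<noteq> 0" "l \<noteq> m"
    using lm(1) by auto
  have dec: "direct_sum_decomposition (E m) (E l)"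
    unfolding E_def by (rule eigenspaces_direct_sum[OF g(2) ne(3) l m])
  have sub: "subspace (E r)" if "r = l \<or> r = m" for r
    using dec that unfolding direct_sum_decomposition_def by blast
  have img: "T ` E r = E r" if "r \<noteq> 0" "r = l \<or> r = m" for r
  proof -
    have "v \<in> T ` E r" if "v \<in> E r" for v
    proof
      show "v = T ((1 / r) *\<^sub>R v)"
        using that \<open>r \<noteq> 0\<close> by (simp add: E_def linear_scale[OF g(2)])
      show "(1 / r) *\<^sub>R v \<in> E r"
        using that by (simp add: E_def linear_scale[OF g(2)])
    qed
    moreover have "T v \<in> E r" if "v \<in> E r" for v
      using that by (simp add: E_def linear_scale[OF g(2)])
    ultimately show ?thesis by blast
  qed
  have pow: "(T ^^ n) v = r ^ n *\<^sub>R v" if "v \<in> E r" for n r v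
    using funpow_eigenvector[OF g(2)] that by (simp add: E_def)
  have "E r \<noteq> {}" for r
    unfolding E_def using linear_0[OF g(2)] by (metis (mono_tags) empty_iff mem_Collect_eq scaleR_zero_right)
  have der: "torus_derivative (g ^^ n) p = T ^^ n" for n p
  proof -
    obtain d where "has_affine_lift (g ^^ n) (T ^^ n) d"
      by (rule has_affine_lift_funpow[OF g])
    then show ?thesis
      by (rule torus_derivative_affine) (rule linear_funpow[OF g(2)])
  qed
  have stable: "onorm_on (E m) (T ^^ n) \<le> 1 * \<bar>m\<bar> ^ n" for n
    by (rule onorm_on_le) (simp_all add: \<open>E m \<noteq> {}\<close> pow power_abs)
  have unstable: "onorm_on (E l) (inv_into (E l) (T ^^ n)) \<le> 1 * \<bar>m\<bar> ^ n" for n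
  proof (rule onorm_on_le)
    fix w assume w: "w \<in> E l"
    let ?v = "(1 / l ^ n) *\<^sub>R w"
    have v: "?v \<in> E l"
      using sub[of l] w by (simp add: subspace_scale)
    have "inj_on (T ^^ n) (E l)"
      by (rule inj_onI) (simp add: pow ne)
    then have "inv_into (E l) (T ^^ n) w = ?v"
      by (rule inv_into_f_eq[OF _ v]) (simp add: pow[OF v] ne)
    then show "norm (inv_into (E l) (T ^^ n) w) \<le> 1 * \<bar>m\<bar> ^ n * norm w"
      by (simp add: lm(2) power_abs power_inverse divide_inverse)
  qed (simp_all add: \<open>E l \<noteq> {}\<close>)
  have "torus_diffeo g"
    unfolding torus_diffeo_def
    using \<open>bij g\<close> smooth_torus_map_affine[OF g] smooth_torus_map_affine[OF g'] by blast
  moreover have "\<exists>Es Eu C lam.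
        (\<forall>p. direct_sum_decomposition (Es p) (Eu p)) \<and>
        (\<forall>p. torus_derivative g p ` Es p = Es (g p)) \<and>
        (\<forall>p. torus_derivative g p ` Eu p = Eu (g p)) \<and>
        0 < C \<and> 0 < lam \<and> lam < 1 \<and>
        (\<forall>p. \<forall>n\<ge>1.
           onorm_on (Es p) (torus_derivative (g ^^ n) p) \<le> C * lam ^ n \<and>
           onorm_on (Eu ((g ^^ n) p)) (inv_into (Eu p) (torus_derivative (g ^^ n) p)) \<le> C * lam ^ n)"
    by (rule exI[of _ "\<lambda>_. E m"], rule exI[of _ "\<lambda>_. E l"], rule exI[of _ 1], rule exI[of _ "\<bar>m\<bar>"])
      (use dec img ne m0 stable unstable torus_derivative_affine[OF g] in \<open>simp add: der\<close>)
  ultimately show ?thesis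
    unfolding anosov_diffeo_def by blast
qed

section \<open>Maps of finite order have zero entropy\<close>

text \<open>An itinerary of length \<open>k\<close>, continued periodically, describes the same set of points.\<close>

lemma dynamical_join_periodic:
  assumes "f ^^ k = id" "0 < k" "k \<le> n"
  shows "dynamical_join f \<U> k \<subseteq> dynamical_join f \<U> n"
proof
  fix W assume "W \<in> dynamical_join f \<U> k"
  then obtain V where V: "\<forall>i<k. V i \<in> \<U>" "W = (\<Inter>i<k. (f ^^ i) -` V i)"
    unfolding dynamical_join_def by blast
  have mod: "f ^^ (i mod k) = f ^^ i" for i
    by (rule ext) (use assms(1) in \<open>simp add: funpow_mod_eq\<close>)
  have "W = (\<Inter>i<n. (f ^^ i) -` V (i mod k))"
  proof (intro equalityI subsetI)
    fix x assume x: "x \<in> W"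
    have "(f ^^ i) x \<in> V (i mod k)" for i
    proof -
      have "(f ^^ (i mod k)) x \<in> V (i mod k)"
        using x assms(2) by (auto simp: V(2))
      then show ?thesis by (simp add: mod)
    qed
    then show "x \<in> (\<Inter>i<n. (f ^^ i) -` V (i mod k))" by simp
  next
    fix x assume x: "x \<in> (\<Inter>i<n. (f ^^ i) -` V (i mod k))"
    show "x \<in> W"
      unfolding V(2)
    proof (rule INT_I)
      fix i assume "i \<in> {..<k}"
      then show "x \<in> (f ^^ i) -` V i"
        using INT_D[OF x, of i] assms(3) by simp
    qed
  qed
  then show "W \<in> dynamical_join f \<U> n"
    unfolding dynamical_join_def using V(1) assms(2) by (auto intro!: exI[of _ "\<lambda>i. V (i mod k)"])
qed

lemma dynamical_join_refines:
  assumes "k \<le> n" "W \<in> dynamical_join f \<U> n"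
  shows "\<exists>W'\<in>dynamical_join f \<U> k. W \<subseteq> W'"
proof -
  obtain V where V: "\<forall>i<n. V i \<in> \<U>" "W = (\<Inter>i<n. (f ^^ i) -` V i)"
    using assms(2) unfolding dynamical_join_def by blast
  have "W \<subseteq> (\<Inter>i<k. (f ^^ i) -` V i)"
    unfolding V(2) using assms(1) by (intro INF_superset_mono) auto
  moreover have "(\<Inter>i<k. (f ^^ i) -` V i) \<in> dynamical_join f \<U> k"
    using V(1) assms(1) unfolding dynamical_join_def by auto
  ultimately show ?thesis by blast
qed

definition has_finite_subcover :: "'a set set \<Rightarrow> bool" where
  "has_finite_subcover \<U> \<longleftrightarrow> (\<exists>\<V>\<subseteq>\<U>. finite \<V> \<and> \<Union>\<V> = UNIV)"

lemma cover_number_mono: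
  assumes "has_finite_subcover \<U>" "\<U> \<subseteq> \<U>'"
  shows "cover_number \<U>' \<le> cover_number \<U>"
proof -
  have "\<exists>n. \<exists>\<V>\<subseteq>\<U>. finite \<V> \<and> \<Union>\<V> = UNIV \<and> card \<V> = n"
    using assms(1) unfolding has_finite_subcover_def by blast
  then have "\<exists>\<V>\<subseteq>\<U>. finite \<V> \<and> \<Union>\<V> = UNIV \<and> card \<V> = cover_number \<U>"
    unfolding cover_number_def by (rule LeastI_ex)
  then obtain \<V> where "\<V> \<subseteq> \<U>" "finite \<V>" "\<Union>\<V> = UNIV" "card \<V> = cover_number \<U>"
    by blast
  then show ?thesis
    using assms(2) unfolding cover_number_def[of \<U>'] by (intro Least_le exI[of _ \<V>]) auto
qed

text \<open>Here the cover number is a default value. All that matters is that it is the same for all such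
families, so that it does not contribute to the growth rate.\<close>

lemma cover_number_no_subcover:
  assumes "\<not> has_finite_subcover \<U>"
  shows "cover_number \<U> = (LEAST n. False)"
proof -
  have "\<not> (finite \<V> \<and> \<Union>\<V> = UNIV \<and> card \<V> = n)" if "\<V> \<subseteq> \<U>" for \<V> n
  proof
    assume "finite \<V> \<and> \<Union>\<V> = UNIV \<and> card \<V> = n"
    then have "has_finite_subcover \<U>"
      unfolding has_finite_subcover_def using that by (intro exI[of _ \<V>]) simp
    with assms show False ..
  qed
  then show ?thesis
    unfolding cover_number_def by (simp cong: conj_cong)
qed

text \<open>For \<open>n \<ge> k\<close> the join of length \<open>n\<close> both contains and refines the join of length \<open>k\<close>: the first
bounds its cover number, and the second shows that finite subcovers exist for both joins or for
neither.\<close>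

lemma cover_number_periodic_bounded:
  assumes "f ^^ k = id" "0 < k"
  obtains C where "\<And>n. k \<le> n \<Longrightarrow> cover_number (dynamical_join f \<U> n) \<le> C"
proof (cases "has_finite_subcover (dynamical_join f \<U> k)")
  case True
  then show ?thesis
    using that cover_number_mono dynamical_join_periodic[OF assms] by blast
next
  case False
  have "cover_number (dynamical_join f \<U> n) \<le> (LEAST n. False)" if "k \<le> n" for n
  proof -
    have "\<not> has_finite_subcover (dynamical_join f \<U> n)"
    proof
      assume "has_finite_subcover (dynamical_join f \<U> n)"
      then obtain \<V> where \<V>: "\<V> \<subseteq> dynamical_join f \<U> n" "finite \<V>" "\<Union>\<V> = UNIV"
        unfolding has_finite_subcover_def by blast
      have "\<forall>W\<in>\<V>. \<exists>W'. W' \<in> dynamical_join f \<U> k \<and> W \<subseteq> W'"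
        using dynamical_join_refines[OF \<open>k \<le> n\<close>] \<V>(1) by blast
      then obtain r where r: "\<forall>W\<in>\<V>. r W \<in> dynamical_join f \<U> k \<and> W \<subseteq> r W"
        by (rule bchoice[THEN exE])
      have "\<Union>\<V> \<subseteq> \<Union>(r ` \<V>)"
        using r by blast
      then have "\<Union>(r ` \<V>) = UNIV"
        unfolding \<V>(3) by (rule top.extremum_uniqueI)
      moreover have "r ` \<V> \<subseteq> dynamical_join f \<U> k" "finite (r ` \<V>)"
        using r \<V>(2) by auto
      ultimately show False
        using False unfolding has_finite_subcover_def by blast
    qed
    then show ?thesis
      by (simp add: cover_number_no_subcover)
  qed
  then show ?thesis by (rule that)
qed

theorem topological_entropy_periodic:
  assumes "f ^^ k = id" "0 < k"
  shows "topological_entropy f \<le> 0"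
  unfolding topological_entropy_def
proof (rule SUP_least)
  fix \<U> :: "'a set set"
  obtain C where C: "\<And>n. k \<le> n \<Longrightarrow> cover_number (dynamical_join f \<U> n) \<le> C"
    using cover_number_periodic_bounded[OF assms] by blast
  let ?h = "\<lambda>n. ln (real (cover_number (dynamical_join f \<U> n))) / real n"
  have "?h n \<le> real C / real n" if "k \<le> n" for n
  proof (rule divide_right_mono)
    let ?N = "cover_number (dynamical_join f \<U> n)"
    have "ln (real ?N) \<le> real ?N"
      by (cases "?N = 0") (auto intro: less_imp_le ln_less_self)
    then show "ln (real ?N) \<le> real C"
      using C[OF that] by linarith
  qed simp
  then have "\<forall>\<^sub>F n in sequentially. ereal (?h n) \<le> ereal (real C / real n)"
    unfolding eventually_sequentially by auto
  then have "cover_entropy f \<U> \<le> limsup (\<lambda>n. ereal (real C / real n))"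
    unfolding cover_entropy_def by (rule Limsup_mono)
  also have "\<dots> = 0"
    by (rule lim_imp_Limsup) (use tendsto_ereal[OF lim_const_over_n[of "real C"]] in \<open>simp_all add: zero_ereal_def\<close>)
  finally show "cover_entropy f \<U> \<le> 0" .
qed

section \<open>Affine maps of finite order\<close>

text \<open>A translation commutes with \<open>A\<close> on the torus iff its vector \<open>c\<close> is fixed by \<open>A\<close> modulo the lattice.
The value \<open>N = 1 - trace A + det A\<close> of the characteristic polynomial at \<open>1\<close> annihilates such vectors
modulo the lattice, by the Cayley-Hamilton identity, and it is not zero because \<open>1\<close> is not an
eigenvalue of \<open>A\<close>. So \<open>c\<close> is rational.\<close>

lemma commuting_translation_rational:
  assumes "saddle A" and c: "real_mat A *v c - c \<in> lattice"
  obtains k :: nat where "0 < k" "real k *\<^sub>R c \<in> lattice"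
proof -
  let ?A = "\<lambda>x. real_mat A *v x"
  define N where "N = 1 - trace A + det A"
  have "N \<noteq> 0"
    using assms(1) by (auto simp: saddle_def N_def)
  define b where "b = ?A c - c"
  have Ac: "?A c = c + b"
    by (simp add: b_def)
  have "?A (?A c) = c + b + ?A b"
    unfolding Ac by (simp add: matrix_vector_right_distrib Ac)
  then have "c + b + ?A b = of_int (trace A) *\<^sub>R (c + b) - of_int (det A) *\<^sub>R c"
    using Cayley_Hamilton_2[of A c] by (simp add: Ac)
  then have "of_int N *\<^sub>R c = of_int (trace A) *\<^sub>R b - b - ?A b"
    by (simp add: N_def algebra_simps)
  also have "\<dots> \<in> lattice"
    using c by (intro lattice_diff lattice_scaleR real_mat_lattice) (simp_all add: b_def)
  finally have N: "of_int N *\<^sub>R c \<in> lattice" .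
  have "real (nat \<bar>N\<bar>) *\<^sub>R c \<in> lattice"
  proof (cases "0 \<le> N")
    case True
    then show ?thesis using N by simp
  next
    case False
    then show ?thesis using lattice_minus[OF N] by simp
  qed
  moreover have "0 < nat \<bar>N\<bar>"
    using \<open>N \<noteq> 0\<close> by simp
  ultimately show ?thesis by (rule that[rotated])
qed

lemma funpow_comp_commute:
  assumes "g \<circ> f = f \<circ> g"
  shows "(g ^^ n) \<circ> f = f \<circ> (g ^^ n)"
  by (induction n) (use assms in \<open>auto simp: fun_eq_iff\<close>)

text \<open>The power \<open>g ^^ n\<close> is a translation that commutes with \<open>torus_map A\<close>, so its vector is rational.\<close>

lemma affine_centralizer_finite_order:
  assumes "saddle A" "g \<circ> torus_map A = torus_map A \<circ> g"
    and g: "has_affine_lift g T c" "linear T" and "T ^^ n = id" "0 < n"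
  obtains k where "0 < k" "g ^^ k = id"
proof -
  let ?A = "\<lambda>x. real_mat A *v x"
  obtain d where d: "has_affine_lift (g ^^ n) id d"
    using has_affine_lift_funpow[OF g, of n] assms(5) by metis
  have "torus_proj (?A 0 + d) = torus_proj (?A (0 + d))"
    using fun_cong[OF funpow_comp_commute[OF assms(2), of n], of "torus_proj 0"]
    by (simp add: torus_map_proj has_affine_liftD[OF d])
  then have "d - ?A d \<in> lattice"
    by (simp add: torus_proj_eq_iff)
  then have "?A d - d \<in> lattice"
    using lattice_minus by fastforce
  then obtain k where k: "0 < k" "real k *\<^sub>R d \<in> lattice"
    by (rule commuting_translation_rational[OF assms(1)])
  have iter: "((g ^^ n) ^^ j) (torus_proj x) = torus_proj (x + real j *\<^sub>R d)" for j x
    by (induction j) (simp_all add: has_affine_liftD[OF d] algebra_simps)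
  have "((g ^^ n) ^^ k) p = p" for p
  proof -
    obtain x where x: "torus_proj x = p"
      by (rule torus_proj_surj)
    have "torus_proj (x + real k *\<^sub>R d) = torus_proj x"
      using k(2) by (simp add: torus_proj_eq_iff)
    then show ?thesis
      using iter x by metis
  qed
  then have "g ^^ (n * k) = id"
    by (auto simp: funpow_mult mult.commute)
  then show ?thesis
    using that[of "n * k"] k(1) \<open>0 < n\<close> by simp
qed

section \<open>Centralizer elements of positive entropy\<close>

text \<open>The linear parts of inverse maps are inverse integer matrices.\<close>

lemma affine_inverse_det:
  assumes "has_affine_lift g (\<lambda>x. real_mat B *v x) c" "has_affine_lift h (\<lambda>x. real_mat B' *v x) d"
    and "g \<circ> h = id"
  shows "det B = 1 \<or> det B = -1"
proof -
  have "has_affine_lift id ((\<lambda>x. real_mat B *v x) \<circ> (\<lambda>x. real_mat B' *v x)) (real_mat B *v d + c)"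
    using has_affine_lift_compose[OF assms(1,2) matrix_vector_mul_linear] assms(3) by simp
  moreover have "has_affine_lift id id 0"
    by (simp add: has_affine_lift_def)
  ultimately have "(\<lambda>x. real_mat B *v x) \<circ> (\<lambda>x. real_mat B' *v x) = id"
    by (rule affine_lift_unique) (auto intro: linear_compose simp: linear_id)
  then have "real_mat (B ** B') *v x = real_mat (mat 1) *v x" for x
    by (simp add: real_mat_mult real_mat_one fun_eq_iff flip: matrix_vector_mul_assoc)
  then have "B ** B' = mat 1"
    by (intro real_mat_inj) (simp add: matrix_eq)
  then have "det B * det B' = 1"
    by (metis det_I det_mul)
  then show ?thesis
    using zmult_eq_1_iff by blast
qed

theorem proposition1:
  fixes A :: "int^2^2" and g :: "torus \<Rightarrow> torus"
  assumes "invertible A" and "hyperbolic_matrix A"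
    and "g \<in> homeo_centralizer (torus_map A)"
    and "topological_entropy g > 0"
  shows "\<exists>k::nat. k \<ge> 1 \<and> anosov_diffeo (g ^^ k)"
proof -
  have A: "saddle A"
    by (rule saddle_if_hyperbolic[OF assms(1,2)])
  obtain h where h: "homeomorphism UNIV UNIV g h" and comm: "g \<circ> torus_map A = torus_map A \<circ> g"
    using assms(3) unfolding homeo_centralizer_def by blast
  have cont: "continuous_on UNIV g" "continuous_on UNIV h"
    and inverse: "h (g p) = p" "g (h p) = p" for p
    using h unfolding homeomorphism_def by auto
  have "bij g"
    by (rule bij_betw_byWitness[where f' = h]) (simp_all add: inverse)
  have inv: "inv g = h"
    by (rule inv_equality) (simp_all add: inverse)
  have comm': "h \<circ> torus_map A = torus_map A \<circ> h"
  proof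
    fix p
    have "h (torus_map A (g (h p))) = h (g (torus_map A (h p)))"
      using fun_cong[OF comm, of "h p"] by simp
    then show "(h \<circ> torus_map A) p = (torus_map A \<circ> h) p"
      by (simp add: inverse)
  qed
  obtain B c where B: "has_affine_lift g (\<lambda>x. real_mat B *v x) c" "A ** B = B ** A"
    by (rule centralizer_affine[OF A cont(1) comm])
  obtain B' c' where B': "has_affine_lift h (\<lambda>x. real_mat B' *v x) c'"
    by (rule centralizer_affine[OF A cont(2) comm'])
  have "det B = 1 \<or> det B = -1"
    by (rule affine_inverse_det[OF B(1) B']) (simp add: fun_eq_iff inverse)
  have "saddle B"
  proof (rule ccontr)
    assume "\<not> saddle B"
    then have "((\<lambda>x. real_mat B *v x) ^^ 12) = id"
      by (rule commuting_with_saddle[OF A B(2) \<open>det B = 1 \<or> det B = -1\<close>])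
    then obtain k where "0 < k" "g ^^ k = id"
      by (rule affine_centralizer_finite_order[OF A comm B(1) matrix_vector_mul_linear]) simp
    then have "topological_entropy g \<le> 0"
      using topological_entropy_periodic by blast
    then show False
      using assms(4) by simp
  qed
  then obtain l m :: real where lm: "l + m = of_int (trace B)" "l * m = of_int (det B)"
    "1 < \<bar>l\<bar>" "\<bar>m\<bar> = 1 / \<bar>l\<bar>"
    by (rule saddle_eigenvalues)
  \<comment> \<open>The map itself is Anosov, so the exponent 1 works.\<close>
  have "anosov_diffeo g"
  proof (rule anosov_affine[OF B(1) matrix_vector_mul_linear _ matrix_vector_mul_linear \<open>bij g\<close> _ _ lm(3,4)])
    show "has_affine_lift (inv g) (\<lambda>x. real_mat B' *v x) c'"
      by (simp add: inv B')
  qed (use saddle_factor[of l m B] saddle_factor[of m l B] lm(1,2)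
      in \<open>simp_all add: add.commute mult.commute\<close>)
  then have "anosov_diffeo (g ^^ 1)"
    by simp
  then show ?thesis by blast
qed

end
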